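(* Consider iteration $k$ of the exact linesearch method (described in the context) applied to the minimization of $\frac12 x^THx+c^Tx$ with $H=H^T\succ0$, where $1\le k<r$. Assume that $p_i=\delta_i p_i^{CG}$ with $\delta_i\ne 0$ for $i=0,\dots,k-1$, where $p_i^{CG}$ are the search directions of the method of conjugate gradients. Let $$A_k = I-\frac{1}{g_{k-1}^T p_{k-1}}\, p_{k-1} g_k^T .$$ Then $A_k$ is nonsingular with $$A_k^{-1} = I+\frac{1}{g_{k-1}^T p_{k-1}}\, p_{k-1} g_k^T,$$ and $A_k p_k^{CG}=-g_k$. In addition, if $p_k$ is given by $B_k p_k=-g_k$ with $B_k\in\mathbb{R}^{n\times n}$ nonsingular, then, for any nonzero scalar $\delta_k$, it holds that $p_k=\delta_k p_k^{CG}$ if and only if $$B_k A_k^{-1} g_k=\frac1{\delta_k} g_k,$$ or equivalently if and only if $$B_k=A_k^T W_k A_k \quad\text{for some nonsingular } W_k \text{ with } W_k g_k=\frac1{\delta_k} g_k.$$ Finally, for $B_k=A_k^TW_kA_k$, it holds that $B_k\succ0$ if and only if $W_k\succ 0$.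
   Context: Let $H\in\mathbb{R}^{n\times n}$ with $H=H^T\succ0$ and $c\in\mathbb{R}^n$. For a square real matrix $X$, $X\succ0$ means $x^TXx>0$ for all $x\neq0$. Exact linesearch method: given $x_0\in\mathbb{R}^n$, set $g_0=Hx_0+c$; for $k=0,1,\dots$, as long as $g_k\ne0$, choose a search direction $p_k$ and set $$\theta_k=-\frac{g_k^Tp_k}{p_k^THp_k},\quad x_{k+1}=x_k+\theta_kp_k,\quad g_{k+1}=g_k+\theta_kHp_k .$$ The index $r$ denotes the iteration at which the method terminates, i.e. the first index with $g_r=0$; so $k<r$ means $g_0,\dots,g_k$ are all nonzero. The method of conjugate gradients (CG) is the exact linesearch method with search directions $p_0^{CG}=-g_0$ and $p_k^{CG}=-g_k+\frac{g_k^Tg_k}{g_{k-1}^Tg_{k-1}}p_{k-1}^{CG}$ for $k\ge1$. CG and the method under consideration are started from the same $x_0$; when $p_i=\delta_ip_i^{CG}$ with $\delta_i\neq0$ for $i=0,\dots,k-1$, the iterates $x_i$ and gradients $g_i$, $i=0,\dots,k$, of the two methods coincide. *)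

theory Defs
  imports "HOL-Analysis.Analysis"
begin

text \<open>Positive definiteness in the sense of the quadratic form only; symmetry is not implied.\<close>

definition pos_def :: "real ^ 'n ^ 'n \<Rightarrow> bool" where
  "pos_def X \<longleftrightarrow> (\<forall>x. x \<noteq> 0 \<longrightarrow> x \<bullet> (X *v x) > 0)"

definition outer_prod :: "real ^ 'm \<Rightarrow> real ^ 'n \<Rightarrow> real ^ 'n ^ 'm" where
  "outer_prod u v = (\<chi> i j. u $ i * v $ j)"

text \<open>
  A run of the exact linesearch method is a triple of sequences. The iteration \<open>k\<close> is
  executed only while \<open>g 0, \<dots>, g k\<close> are all nonzero; entries of the sequences beyond
  termination are unconstrained.
\<close>

definition exact_linesearch ::
  "real ^ 'n ^ 'n \<Rightarrow> real ^ 'n \<Rightarrow> real ^ 'n \<Rightarrow>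
   (nat \<Rightarrow> real ^ 'n) \<Rightarrow> (nat \<Rightarrow> real ^ 'n) \<Rightarrow> (nat \<Rightarrow> real ^ 'n) \<Rightarrow> bool" where
  "exact_linesearch H c x0 x g p \<longleftrightarrow>
     x 0 = x0 \<and> g 0 = H *v x0 + c \<and>
     (\<forall>k. (\<forall>i\<le>k. g i \<noteq> 0) \<longrightarrow>
        (let \<theta> = - (g k \<bullet> p k) / (p k \<bullet> (H *v p k)) in
          x (Suc k) = x k + \<theta> *\<^sub>R p k \<and>
          g (Suc k) = g k + \<theta> *\<^sub>R (H *v p k)))"

definition conjugate_gradients ::
  "real ^ 'n ^ 'n \<Rightarrow> real ^ 'n \<Rightarrow> real ^ 'n \<Rightarrow>
   (nat \<Rightarrow> real ^ 'n) \<Rightarrow> (nat \<Rightarrow> real ^ 'n) \<Rightarrow> (nat \<Rightarrow> real ^ 'n) \<Rightarrow> bool" where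
  "conjugate_gradients H c x0 x g p \<longleftrightarrow>
     exact_linesearch H c x0 x g p \<and>
     (\<forall>k. (\<forall>i\<le>k. g i \<noteq> 0) \<longrightarrow>
        p k = (if k = 0 then - g 0
               else - g k + ((g k \<bullet> g k) / (g (k - 1) \<bullet> g (k - 1))) *\<^sub>R p (k - 1)))"

end

theory Submission
  imports Defs
begin

text \<open>
  Write \<open>q\<close> for the previous direction. Exactness of the linesearch gives \<open>g k \<bullet> q = 0\<close>, so the
  rank-one matrix \<open>q g\<^sub>k\<^sup>T\<close> squares to zero: this yields \<open>A\<inverse>\<close>, and also that \<open>A\<^sup>T\<close> and its inverse
  fix \<open>g k\<close>. The CG recursion says precisely that \<open>p_CG k = - A\<inverse> g\<^sub>k\<close>, since
  \<open>g\<^sub>k\<^sub>-\<^sub>1 \<bullet> p_CG (k - 1) = - \<parallel>g\<^sub>k\<^sub>-\<^sub>1\<parallel>\<^sup>2\<close>. The characterisations of \<open>B\<close> follow by applying \<open>B\<close> and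
  \<open>A\<^sup>-\<^sup>T B A\<inverse>\<close> to these vectors.
\<close>

lemma outer_prod_mult_vec: "outer_prod u v *v x = (v \<bullet> x) *\<^sub>R u"
  by (simp add: vec_eq_iff outer_prod_def matrix_vector_mult_def inner_vec_def
      sum_distrib_left mult.commute mult.left_commute)

lemma mat_1_plus_outer_prod_mult_vec:
  fixes u v x :: "real ^ 'n"
  shows "(mat 1 + a *\<^sub>R outer_prod u v) *v x = x + (a * (v \<bullet> x)) *\<^sub>R u"
  by (simp add: matrix_vector_mult_add_rdistrib scaleR_matrix_vector_assoc[symmetric]
      outer_prod_mult_vec)

lemma transpose_mat_1_plus_outer_prod:
  fixes u v :: "real ^ 'n"
  shows "transpose (mat 1 + a *\<^sub>R outer_prod u v) = mat 1 + a *\<^sub>R outer_prod v u"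
  by (simp add: vec_eq_iff outer_prod_def transpose_def mat_def mult.commute)

text \<open>The linear terms cancel, and the quadratic one carries the factor
  \<open>v \<bullet> u\<close>.\<close>

lemma mat_1_plus_outer_prod_mult_inverse:
  fixes u v :: "real ^ 'n"
  assumes "v \<bullet> u = 0"
  shows "(mat 1 + a *\<^sub>R outer_prod u v) ** (mat 1 + (- a) *\<^sub>R outer_prod u v) = mat 1"
proof -
  have "((mat 1 + a *\<^sub>R outer_prod u v) ** (mat 1 + (- a) *\<^sub>R outer_prod u v)) *v x = mat 1 *v x"
    for x
    unfolding matrix_vector_mul_assoc[symmetric] mat_1_plus_outer_prod_mult_vec
    using assms by (simp add: inner_add_right inner_diff_right)
  then show ?thesis
    by (simp add: matrix_eq)
qed

text \<open>\<open>matrix_inv\<close> is a choice of a two-sided inverse, so its equations become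
  available only once invertibility is known; for square matrices a right inverse supplies
  that.\<close>

lemma matrix_inv_eqI:
  fixes A :: "real ^ 'n ^ 'n"
  assumes "A ** M = mat 1"
  shows "matrix_inv A = M"
proof -
  have "invertible A"
    using assms invertible_right_inverse by blast
  then have "matrix_inv A ** A = mat 1"
    unfolding invertible_def matrix_inv_def by (metis (mono_tags, lifting) someI_ex)
  then show ?thesis
    by (metis assms matrix_mul_assoc matrix_mul_lid matrix_mul_rid)
qed

text \<open>The quadratic form of the product at \<open>x\<close> is that of \<open>W\<close> at
  \<open>A *v x\<close>, and \<open>A\<close> permutes the nonzero vectors.\<close>

lemma pos_def_congruence:
  fixes A W :: "real ^ 'n ^ 'n"
  assumes "invertible A"
  shows "pos_def (transpose A ** W ** A) \<longleftrightarrow> pos_def W"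
proof -
  have form: "x \<bullet> ((transpose A ** W ** A) *v x) = (A *v x) \<bullet> (W *v (A *v x))" for x
    by (metis dot_lmul_matrix matrix_vector_mul_assoc vector_transpose_matrix transpose_transpose)
  obtain M where "A ** M = mat 1" "M ** A = mat 1"
    using assms unfolding invertible_def by blast
  then have inv: "A *v (M *v y) = y" "M *v (A *v y) = y" for y
    by (simp_all add: matrix_vector_mul_assoc)
  show ?thesis
    unfolding pos_def_def form by (metis inv matrix_vector_mult_0_right)
qed

text \<open>The step length is the zero of the directional derivative along \<open>p k\<close>; for
  \<open>p k \<noteq> 0\<close> its denominator is positive and cancels.\<close>

lemma exact_linesearch_orthogonal:
  assumes "pos_def H" and "exact_linesearch H c x0 x g p" and "\<forall>i\<le>k. g i \<noteq> 0"
  shows "g (Suc k) \<bullet> p k = 0"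
proof (cases "p k = 0")
  case False
  then have "p k \<bullet> (H *v p k) > 0"
    using assms(1) by (simp add: pos_def_def)
  moreover have "g (Suc k) = g k + (- (g k \<bullet> p k) / (p k \<bullet> (H *v p k))) *\<^sub>R (H *v p k)"
    using assms(2,3) by (simp add: exact_linesearch_def Let_def)
  ultimately show ?thesis
    by (simp add: inner_diff_left inner_diff_right inner_commute)
qed simp

text \<open>The correction added to \<open>- g k\<close> is a multiple of the previous direction, to
  which \<open>g k\<close> is orthogonal by exactness.\<close>

lemma conjugate_gradients_descent:
  assumes "pos_def H" and "conjugate_gradients H c x0 x g p" and nz: "\<forall>i\<le>k. g i \<noteq> 0"
  shows "g k \<bullet> p k = - (g k \<bullet> g k)"
proof -
  have p: "p k = (if k = 0 then - g 0
      else - g k + ((g k \<bullet> g k) / (g (k - 1) \<bullet> g (k - 1))) *\<^sub>R p (k - 1))"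
    using assms(2) nz unfolding conjugate_gradients_def by blast
  show ?thesis
  proof (cases k)
    case 0
    then show ?thesis using p by simp
  next
    case (Suc m)
    then have "g k \<bullet> p (k - 1) = 0"
      using exact_linesearch_orthogonal[of H c x0 x g p m] assms
      by (simp add: conjugate_gradients_def)
    then show ?thesis
      using Suc by (subst p) (simp add: inner_diff_right)
  qed
qed

text \<open>An exact step is invariant under rescaling of its direction: multiplying the direction
  by \<open>\<delta>\<close> divides the step length by \<open>\<delta>\<close>.\<close>

lemma exact_linesearch_gradients_coincide:
  assumes "exact_linesearch H c x0 x g p" and "exact_linesearch H c x0 x' g' p'"
    and nz: "\<forall>i<k. g i \<noteq> 0"
    and par: "\<forall>i<k. \<delta> i \<noteq> 0 \<and> p i = \<delta> i *\<^sub>R p' i"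
    and "i \<le> k"
  shows "g i = g' i"
  using \<open>i \<le> k\<close>
proof (induction i rule: less_induct)
  case (less i)
  show ?case
  proof (cases i)
    case 0
    then show ?thesis using assms(1,2) by (simp add: exact_linesearch_def)
  next
    case (Suc m)
    \<comment> \<open>Agreement at all indices up to \<open>m\<close> is used, not only at
      \<open>m\<close>: the second run is known to perform iteration \<open>m\<close> only if
      \<open>g' 0\<close>, ..., \<open>g' m\<close> are all nonzero.\<close>
    have eq: "g j = g' j" if "j \<le> m" for j
      using less that Suc by simp
    have "\<forall>j\<le>m. g j \<noteq> 0"
      using nz less.prems Suc by simp
    moreover from this have "\<forall>j\<le>m. g' j \<noteq> 0"
      using eq by auto
    ultimately have "g i = g m + (- (g m \<bullet> p m) / (p m \<bullet> (H *v p m))) *\<^sub>R (H *v p m)"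
      and "g' i = g' m + (- (g' m \<bullet> p' m) / (p' m \<bullet> (H *v p' m))) *\<^sub>R (H *v p' m)"
      using assms(1,2) Suc by (simp_all add: exact_linesearch_def Let_def)
    moreover have "\<delta> m \<noteq> 0" "p m = \<delta> m *\<^sub>R p' m"
      using par less.prems Suc by auto
    ultimately show ?thesis
      by (simp add: eq matrix_vector_mult_scaleR)
  qed
qed

theorem proposition3p1:
  fixes H A :: "real ^ 'n ^ 'n" and c x0 :: "real ^ 'n"
    and x g p x_CG g_CG p_CG :: "nat \<Rightarrow> real ^ 'n"
    and \<delta> :: "nat \<Rightarrow> real" and k :: nat
  assumes "transpose H = H" and "pos_def H"
    and "exact_linesearch H c x0 x g p"
    and "conjugate_gradients H c x0 x_CG g_CG p_CG"
    and "1 \<le> k" and "\<forall>i\<le>k. g i \<noteq> 0"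
    and "\<forall>i<k. \<delta> i \<noteq> 0 \<and> p i = \<delta> i *\<^sub>R p_CG i"
    and "A = mat 1 - (1 / (g (k - 1) \<bullet> p (k - 1))) *\<^sub>R outer_prod (p (k - 1)) (g k)"
  shows "invertible A
    \<and> matrix_inv A = mat 1 + (1 / (g (k - 1) \<bullet> p (k - 1))) *\<^sub>R outer_prod (p (k - 1)) (g k)
    \<and> A *v p_CG k = - g k
    \<and> (\<forall>(B :: real ^ 'n ^ 'n) (\<delta>\<^sub>k :: real).
         invertible B \<and> B *v p k = - g k \<and> \<delta>\<^sub>k \<noteq> 0 \<longrightarrow>
           (p k = \<delta>\<^sub>k *\<^sub>R p_CG k \<longleftrightarrow> B *v (matrix_inv A *v g k) = (1 / \<delta>\<^sub>k) *\<^sub>R g k)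
         \<and> (p k = \<delta>\<^sub>k *\<^sub>R p_CG k \<longleftrightarrow>
              (\<exists>W :: real ^ 'n ^ 'n. invertible W \<and> W *v g k = (1 / \<delta>\<^sub>k) *\<^sub>R g k
                 \<and> B = transpose A ** W ** A)))
    \<and> (\<forall>(B :: real ^ 'n ^ 'n) (W :: real ^ 'n ^ 'n).
         B = transpose A ** W ** A \<longrightarrow> (pos_def B \<longleftrightarrow> pos_def W))"
proof -
  define q where "q = p (k - 1)"
  define a where "a = 1 / (g (k - 1) \<bullet> q)"
  obtain m where m: "k = Suc m"
    using \<open>1 \<le> k\<close> by (cases k) auto
  have CG: "exact_linesearch H c x0 x_CG g_CG p_CG"
    using assms(4) by (simp add: conjugate_gradients_def)
  have geq: "g i = g_CG i" if "i \<le> k" for i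
    using exact_linesearch_gradients_coincide[OF assms(3) CG _ assms(7) that] assms(6) by simp
  then have nzCG: "\<forall>i\<le>k. g_CG i \<noteq> 0"
    using assms(6) by metis
  have \<delta>m: "\<delta> m \<noteq> 0" and q: "q = \<delta> m *\<^sub>R p_CG m"
    using assms(7) m by (auto simp: q_def)
  have gq: "g k \<bullet> q = 0"
    using exact_linesearch_orthogonal[OF assms(2,3), of m] assms(6) m by (simp add: q_def)
  have gm: "g m \<bullet> g m \<noteq> 0"
    using assms(6) m by simp
  \<comment> \<open>The scaling of \<open>q\<close> contributes \<open>\<delta> m\<close>, and the
    descent identity for CG turns \<open>g m \<bullet> p_CG m\<close> into
    \<open>- (g m \<bullet> g m)\<close>.\<close>
  have a: "a = - 1 / (\<delta> m * (g m \<bullet> g m))"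
    using conjugate_gradients_descent[OF assms(2,4), of m] nzCG geq[of m] m
    by (simp add: a_def q)

  define A' where "A' = mat 1 + a *\<^sub>R outer_prod q (g k)"
  have A: "A = mat 1 + (- a) *\<^sub>R outer_prod q (g k)"
    using assms(8) by (simp add: a_def q_def)
  have AA': "A ** A' = mat 1"
    using mat_1_plus_outer_prod_mult_inverse[OF gq, of "- a"] by (simp add: A A'_def)
  have A'A: "A' ** A = mat 1"
    using AA' matrix_left_right_inverse by blast
  have invA: "invertible A"
    using AA' A'A unfolding invertible_def by blast
  have inv_eq: "matrix_inv A = A'"
    using AA' by (rule matrix_inv_eqI)
  have tA: "transpose A *v g k = g k" and tA': "transpose A' *v g k = g k"
    using gq unfolding A A'_def transpose_mat_1_plus_outer_prod mat_1_plus_outer_prod_mult_vec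
    by (simp_all add: inner_commute)

  have "p_CG k = - g k + ((g k \<bullet> g k) / (g m \<bullet> g m)) *\<^sub>R p_CG m"
    using assms(4) nzCG m geq[of k] geq[of m] by (simp add: conjugate_gradients_def)
  \<comment> \<open>The factor \<open>\<delta> m\<close> cancels in \<open>a *\<^sub>R q\<close>,
    which leaves \<open>p_CG m\<close> divided by \<open>- (g m \<bullet> g m)\<close>.\<close>
  also have "\<dots> = - (A' *v g k)"
    unfolding A'_def mat_1_plus_outer_prod_mult_vec using \<delta>m gm by (simp add: a q)
  finally have pCG: "p_CG k = - (A' *v g k)" .
  then have ApCG: "A *v p_CG k = - g k"
    by (simp add: vec.neg matrix_vector_mul_assoc AA')

  have dir: "p k = d *\<^sub>R p_CG k \<longleftrightarrow> B *v (A' *v g k) = (1 / d) *\<^sub>R g k"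
    if "invertible B" "B *v p k = - g k" "d \<noteq> 0" for B :: "real ^ 'n ^ 'n" and d :: real
  proof -
    have scale: "u = d *\<^sub>R v \<longleftrightarrow> v = (1 / d) *\<^sub>R u" for u v :: "real ^ 'n"
      using \<open>d \<noteq> 0\<close> by auto
    \<comment> \<open>As \<open>B\<close> is injective, both directions can be compared through
      their images under \<open>B\<close>, namely \<open>- g k\<close> and \<open>- d\<close> times
      \<open>B *v (A' *v g k)\<close>.\<close>
    have "p k = d *\<^sub>R p_CG k \<longleftrightarrow> B *v p k = B *v (d *\<^sub>R p_CG k)"
      using \<open>invertible B\<close> by (metis invertible_def matrix_vector_mul_assoc matrix_vector_mul_lid)
    also have "\<dots> \<longleftrightarrow> g k = d *\<^sub>R (B *v (A' *v g k))"
      by (simp add: that(2) pCG vec.neg matrix_vector_mult_scaleR)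
    also have "\<dots> \<longleftrightarrow> B *v (A' *v g k) = (1 / d) *\<^sub>R g k"
      by (rule scale)
    finally show ?thesis .
  qed
  have factor: "B *v (A' *v g k) = b *\<^sub>R g k \<longleftrightarrow>
      (\<exists>W :: real ^ 'n ^ 'n. invertible W \<and> W *v g k = b *\<^sub>R g k \<and> B = transpose A ** W ** A)"
    if "invertible B" for B :: "real ^ 'n ^ 'n" and b :: real
  proof
    assume l: "B *v (A' *v g k) = b *\<^sub>R g k"
    \<comment> \<open>Solving \<open>B = transpose A ** W ** A\<close> for \<open>W\<close> forces
      this choice; it scales \<open>g k\<close> by \<open>b\<close> because
      \<open>transpose A'\<close> fixes \<open>g k\<close>.\<close>
    define W where "W = transpose A' ** B ** A'"
    have "invertible A'"
      using AA' A'A unfolding invertible_def by blast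
    then have "invertible W"
      using that by (simp add: W_def invertible_det_nz det_mul det_transpose)
    moreover have "W *v g k = b *\<^sub>R g k"
      using tA' by (simp add: W_def matrix_vector_mul_assoc[symmetric] l matrix_vector_mult_scaleR)
    moreover have "transpose A ** W ** A = transpose (A' ** A) ** B ** (A' ** A)"
      by (simp only: W_def matrix_transpose_mul matrix_mul_assoc)
    then have "B = transpose A ** W ** A"
      by (simp add: A'A transpose_mat)
    ultimately show "\<exists>W :: real ^ 'n ^ 'n. invertible W \<and> W *v g k = b *\<^sub>R g k
        \<and> B = transpose A ** W ** A"
      by blast
  next
    assume "\<exists>W :: real ^ 'n ^ 'n. invertible W \<and> W *v g k = b *\<^sub>R g k
        \<and> B = transpose A ** W ** A"
    then obtain W :: "real ^ 'n ^ 'n"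
      where W: "W *v g k = b *\<^sub>R g k" "B = transpose A ** W ** A"
      by blast
    have "B *v (A' *v g k) = transpose A *v (W *v ((A ** A') *v g k))"
      by (simp only: W(2) matrix_vector_mul_assoc matrix_mul_assoc)
    then show "B *v (A' *v g k) = b *\<^sub>R g k"
      using tA by (simp add: AA' W(1) matrix_vector_mult_scaleR)
  qed
  show ?thesis
    using invA inv_eq ApCG dir factor pos_def_congruence[OF invA]
    by (simp add: A'_def a_def q_def)
qed

end
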